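(* Every max-extreme point of $MDS_n(\mathbb{R}_{\max})$ is of the form $P_1\otimes E_1\otimes P_2$ or $P_1\otimes E_2\otimes P_2$, where $P_1,P_2\in\mathbf{P}_n(\mathbb{R}_{\max})$ are permutation matrices and $E_1$, $E_2$ are $n\times n$ matrices of the following forms: $$E_1=\mathbf{1}_{m_1}\boxplus\cdots\boxplus\mathbf{1}_{m_k}\boxplus\mathbf{1}_{n_1}^T\boxplus\cdots\boxplus\mathbf{1}_{n_t}^T,$$ where $t,k\ge 0$, and $$E_2=\begin{pmatrix}1&1&\cdots&1\\1&0&\cdots&0\\\vdots&\vdots&\ddots&\vdots\\1&0&\cdots&0\end{pmatrix}_{q\times r}\boxplus\left(\mathbf{1}_{m_1}\boxplus\cdots\boxplus\mathbf{1}_{m_k}\boxplus\mathbf{1}_{n_1}^T\boxplus\cdots\boxplus\mathbf{1}_{n_t}^T\right),$$ where $q,r>1$ and $t,k\ge 0$ (here the $m_i$ and $n_j$ are positive integers, and the $q\times r$ block has all entries of its first row and first column equal to $1$ and all other entries $0$).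
   Context: Max algebra: $\mathbb{R}_{\max}$ denotes the semiring $(\mathbb{R}_{\ge 0},\oplus,\otimes)$ with $a\oplus b=\max(a,b)$ and $a\otimes b=ab$. $M_n(\mathbb{R}_{\max})$ is the set of $n\times n$ matrices with entries in $\mathbb{R}_{\ge 0}$. Addition $\oplus$ of matrices is entrywise maximum, scalars act by entrywise multiplication, and $(A\otimes B)_{i,j}=\max_k a_{i,k}b_{k,j}$. Let $\mathbf{1}_m$ be the column vector of length $m$ with all entries $1$. A matrix $D\in M_n(\mathbb{R}_{\max})$ is max-doubly stochastic if $D\otimes\mathbf{1}_n=\mathbf{1}_n$ and $\mathbf{1}_n^T\otimes D=\mathbf{1}_n^T$; $MDS_n(\mathbb{R}_{\max})$ is the set of all such matrices, and it is max-convex, i.e. closed under $\alpha_1s_1\oplus\alpha_2s_2$ with $\alpha_1,\alpha_2\in\mathbb{R}_{\max}$, $\alpha_1\oplus\alpha_2=1$. An element $s$ of a max-convex set $S$ is a max-extreme point of $S$ if for all $s_1,s_2\in S$ and $\alpha_1,\alpha_2\in\mathbb{R}_{\max}$ with $\alpha_1\oplus\alpha_2=1$ and $s=\alpha_1s_1\oplus\alpha_2s_2$, it follows that $s=s_1$ or $s=s_2$. $\mathbf{P}_n(\mathbb{R}_{\max})$ is the set of $n\times n$ permutation matrices (obtained from the usual identity matrix by permuting rows and/or columns). For (possibly rectangular) matrices $A$ and $B$, the direct sum is the block matrix $A\boxplus B=\begin{pmatrix}A&0\\0&B\end{pmatrix}$. *)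

theory Defs
  imports "Jordan_Normal_Form.Matrix" "HOL-Combinatorics.Permutations"
begin

text \<open>The max-times semiring, written with the class operations so that matrix sums, products and
  scalar multiples over it are those of the library: below, \<open>+\<close> is the maximum and \<open>*\<close> is the
  product of nonnegative reals.\<close>

typedef rmax = "{x :: real. 0 \<le> x}"
  morphisms real_of_rmax Abs_rmax
  by auto

setup_lifting type_definition_rmax

instantiation rmax :: comm_semiring_1
begin

lift_definition zero_rmax :: rmax is 0 by simp
lift_definition one_rmax :: rmax is 1 by simp
lift_definition plus_rmax :: "rmax \<Rightarrow> rmax \<Rightarrow> rmax" is max by simp
lift_definition times_rmax :: "rmax \<Rightarrow> rmax \<Rightarrow> rmax" is "(*)" by simp

instance
proof
  fix a b c :: rmax
  show "a + b + c = a + (b + c)" by transfer (simp add: max.assoc)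
  show "a + b = b + a" by transfer (simp add: max.commute)
  show "0 + a = a" by transfer simp
  show "a * b * c = a * (b * c)" by transfer simp
  show "a * b = b * a" by transfer simp
  show "1 * a = a" by transfer simp
  show "(a + b) * c = a * c + b * c" by transfer (simp add: max_mult_distrib_right)
  show "0 * a = 0" by transfer simp
  show "a * 0 = 0" by transfer simp
  show "(0 :: rmax) \<noteq> 1" by transfer simp
qed

end

lemma real_of_rmax_sum:
  assumes "finite K" "K \<noteq> {}"
  shows "real_of_rmax (\<Sum>k\<in>K. f k) = Max ((\<lambda>k. real_of_rmax (f k)) ` K)"
  using assms by (induction K rule: finite_ne_induct) (simp_all add: plus_rmax.rep_eq)

lemma real_of_rmax_mat_mult:
  assumes "A \<in> carrier_mat l m" "B \<in> carrier_mat m n" "i < l" "j < n" "0 < m"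
  shows "real_of_rmax ((A * B) $$ (i, j)) =
    Max ((\<lambda>k. real_of_rmax (A $$ (i, k)) * real_of_rmax (B $$ (k, j))) ` {0..<m})"
proof -
  have "(A * B) $$ (i, j) = (\<Sum>k\<in>{0..<m}. A $$ (i, k) * B $$ (k, j))"
    using assms by (simp add: scalar_prod_def)
  then show ?thesis
    using assms by (simp add: real_of_rmax_sum times_rmax.rep_eq)
qed

definition ones_col :: "nat \<Rightarrow> rmax mat" where
  "ones_col m = mat m 1 (\<lambda>_. 1)"

definition MDS :: "nat \<Rightarrow> rmax mat set" where
  "MDS n = {D \<in> carrier_mat n n.
     D * ones_col n = ones_col n \<and>
     transpose_mat (ones_col n) * D = transpose_mat (ones_col n)}"

definition max_convex :: "rmax mat set \<Rightarrow> bool" where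
  "max_convex S \<longleftrightarrow> (\<forall>s1\<in>S. \<forall>s2\<in>S. \<forall>\<alpha>1 \<alpha>2. \<alpha>1 + \<alpha>2 = 1 \<longrightarrow> \<alpha>1 \<cdot>\<^sub>m s1 + \<alpha>2 \<cdot>\<^sub>m s2 \<in> S)"

definition max_extreme_point :: "rmax mat set \<Rightarrow> rmax mat \<Rightarrow> bool" where
  "max_extreme_point S s \<longleftrightarrow> s \<in> S \<and>
     (\<forall>s1\<in>S. \<forall>s2\<in>S. \<forall>\<alpha>1 \<alpha>2. \<alpha>1 + \<alpha>2 = 1 \<and> s = \<alpha>1 \<cdot>\<^sub>m s1 + \<alpha>2 \<cdot>\<^sub>m s2
        \<longrightarrow> s = s1 \<or> s = s2)"

lemma smult_one_plus:
  fixes M :: "rmax mat"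
  assumes "\<alpha> + \<beta> = 1"
  shows "\<alpha> \<cdot>\<^sub>m M + \<beta> \<cdot>\<^sub>m M = M"
  using assms by (intro eq_matI) (auto simp flip: distrib_right)

lemma max_convex_MDS: "max_convex (MDS n)"
  unfolding max_convex_def
proof (intro ballI allI impI)
  fix A B :: "rmax mat" and \<alpha> \<beta> :: rmax
  assume A: "A \<in> MDS n" and B: "B \<in> MDS n" and ab: "\<alpha> + \<beta> = 1"
  have [simp]: "A \<in> carrier_mat n n" "B \<in> carrier_mat n n"
    using A B by (auto simp: MDS_def)
  have c[simp]: "ones_col n \<in> carrier_mat n (Suc 0)"
    by (simp add: ones_col_def)
  have ct[simp]: "transpose_mat (ones_col n) \<in> carrier_mat (Suc 0) n"
    by simp
  have "(\<alpha> \<cdot>\<^sub>m A + \<beta> \<cdot>\<^sub>m B) * ones_col n = \<alpha> \<cdot>\<^sub>m (A * ones_col n) + \<beta> \<cdot>\<^sub>m (B * ones_col n)"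
    by (subst add_mult_distrib_mat[of _ n n _ _ "Suc 0"])
      (simp_all add: mult_smult_assoc_mat[of _ n n _ "Suc 0"])
  moreover have "transpose_mat (ones_col n) * (\<alpha> \<cdot>\<^sub>m A + \<beta> \<cdot>\<^sub>m B) =
      \<alpha> \<cdot>\<^sub>m (transpose_mat (ones_col n) * A) + \<beta> \<cdot>\<^sub>m (transpose_mat (ones_col n) * B)"
    by (subst mult_add_distrib_mat[of _ "Suc 0" n _ n])
      (simp_all add: mult_smult_distrib[of _ "Suc 0" n _ n])
  ultimately show "\<alpha> \<cdot>\<^sub>m A + \<beta> \<cdot>\<^sub>m B \<in> MDS n"
    using A B by (simp add: MDS_def smult_one_plus[OF ab])
qed

text \<open>The identity matrix with its rows permuted by \<open>p\<close> and its columns by \<open>q\<close>.\<close>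

definition permutation_matrices :: "nat \<Rightarrow> rmax mat set" where
  "permutation_matrices n =
     {mat n n (\<lambda>(i, j). 1\<^sub>m n $$ (p i, q j)) | p q. p permutes {..<n} \<and> q permutes {..<n}}"

text \<open>The direct sum of (possibly rectangular) blocks is the library's \<^const>\<open>diag_block_mat\<close>.
  Either list may be empty.\<close>

definition ones_sum :: "nat list \<Rightarrow> nat list \<Rightarrow> rmax mat" where
  "ones_sum ms ns =
     diag_block_mat (map ones_col ms @ map (\<lambda>m. transpose_mat (ones_col m)) ns)"

definition hook_mat :: "nat \<Rightarrow> nat \<Rightarrow> rmax mat" where
  "hook_mat q r = mat q r (\<lambda>(i, j). if i = 0 \<or> j = 0 then 1 else 0)"

definition E1_form :: "nat \<Rightarrow> rmax mat \<Rightarrow> bool" where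
  "E1_form n E \<longleftrightarrow> E \<in> carrier_mat n n \<and>
     (\<exists>ms ns. (\<forall>m\<in>set ms. 0 < m) \<and> (\<forall>m\<in>set ns. 0 < m) \<and> E = ones_sum ms ns)"

definition E2_form :: "nat \<Rightarrow> rmax mat \<Rightarrow> bool" where
  "E2_form n E \<longleftrightarrow> E \<in> carrier_mat n n \<and>
     (\<exists>q r ms ns. 1 < q \<and> 1 < r \<and> (\<forall>m\<in>set ms. 0 < m) \<and> (\<forall>m\<in>set ns. 0 < m) \<and>
        E = diag_block_mat [hook_mat q r, ones_sum ms ns])"

end

theory Submission
  imports Defs
begin

text \<open>
  Membership in \<^const>\<open>MDS\<close> means that all entries are at most \<open>1\<close> and that every row and every
  column contains a \<open>1\<close>. A max-extreme matrix \<open>D\<close> first of all has only the entries \<open>0\<close> and \<open>1\<close>: an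
  entry \<open>a\<close> strictly between them splits off, because \<open>D\<close> is the maximum of \<open>D\<close> with that entry
  erased and of \<open>a\<close> times the matrix \<open>min 1 (D / a)\<close> (lemma \<open>extreme_zero_one\<close>).

  A zero-one matrix is read as a bipartite graph between rows and columns, without isolated vertices.
  An edge both of whose ends have further edges can be erased without leaving \<^const>\<open>MDS\<close>, and if
  two different edges can be erased, then \<open>D\<close> is the maximum of the two smaller matrices. An extreme
  \<open>D\<close> thus has at most one erasable edge (lemma \<open>extreme_erasable_unique\<close>).

  If there is none, every edge has an end of degree one, so the graph is a disjoint union of stars;
  a star centred at a column is a column of ones and a star centred at a row is a row of ones
  (lemma \<open>star_forest_biadjacency\<close>). If there is exactly one erasable edge, all further edges at
  its two ends lead to vertices of degree one, so that its component is a double star. The matrix of a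
  double star, with its centres listed first, is the hook block, and the other components are again
  stars (lemma \<open>double_star_biadjacency\<close>). The enumerations of rows and columns that bring the
  matrix to block form are the required permutations.
\<close>

section \<open>Max-doubly stochastic matrices\<close>

lemma rmax_add_eq_1_iff:
  fixes a b :: rmax
  shows "a + b = 1 \<longleftrightarrow> real_of_rmax a \<le> 1 \<and> real_of_rmax b \<le> 1 \<and> (a = 1 \<or> b = 1)"
  by transfer (auto simp: max_def)

lemma real_of_rmax_1 [simp]: "real_of_rmax 1 = 1"
  by transfer simp

lemma real_of_rmax_0 [simp]: "real_of_rmax 0 = 0"
  by transfer simp

lemma rmax_idem [simp]: "a + a = a" for a :: rmax
  by transfer simp

lemma rmax_sum_eq_1_iff:
  fixes f :: "'a \<Rightarrow> rmax"
  assumes "finite K"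
  shows "(\<Sum>k\<in>K. f k) = 1 \<longleftrightarrow> (\<forall>k\<in>K. real_of_rmax (f k) \<le> 1) \<and> (\<exists>k\<in>K. f k = 1)"
  using assms
proof (induction K)
  case (insert x K)
  have le: "real_of_rmax (\<Sum>k\<in>K. f k) \<le> 1 \<longleftrightarrow> (\<forall>k\<in>K. real_of_rmax (f k) \<le> 1)"
    using insert.hyps(1)
    by (induction K) (auto simp: plus_rmax.rep_eq)
  show ?case
    using insert by (auto simp: rmax_add_eq_1_iff le)
qed simp

lemma MDS_iff:
  "D \<in> MDS n \<longleftrightarrow> D \<in> carrier_mat n n \<and> (\<forall>i<n. \<forall>j<n. real_of_rmax (D $$ (i, j)) \<le> 1) \<and>
     (\<forall>i<n. \<exists>j<n. D $$ (i, j) = 1) \<and> (\<forall>j<n. \<exists>i<n. D $$ (i, j) = 1)"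
proof (cases "D \<in> carrier_mat n n")
  case True
  have rows: "D * ones_col n = ones_col n \<longleftrightarrow> (\<forall>i<n. (\<Sum>j\<in>{0..<n}. D $$ (i, j)) = 1)"
    using True by (auto simp: ones_col_def mat_eq_iff scalar_prod_def)
  have cols: "transpose_mat (ones_col n) * D = transpose_mat (ones_col n) \<longleftrightarrow>
      (\<forall>j<n. (\<Sum>i\<in>{0..<n}. D $$ (i, j)) = 1)"
    using True by (auto simp: ones_col_def mat_eq_iff scalar_prod_def)
  show ?thesis
    using True unfolding MDS_def by (simp add: rows cols rmax_sum_eq_1_iff) (auto simp: Bex_def)
qed (simp add: MDS_def)

lemma max_extreme_pointD:
  assumes "max_extreme_point S D" "A \<in> S" "B \<in> S" "\<alpha> + \<beta> = 1" "D = \<alpha> \<cdot>\<^sub>m A + \<beta> \<cdot>\<^sub>m B"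
  shows "D = A \<or> D = B"
  using assms unfolding max_extreme_point_def by blast

definition erase_entry :: "nat \<Rightarrow> nat \<Rightarrow> rmax mat \<Rightarrow> rmax mat" where
  "erase_entry k l D =
     mat (dim_row D) (dim_col D) (\<lambda>(i, j). if i = k \<and> j = l then 0 else D $$ (i, j))"

lemma erase_entry_MDS:
  assumes D: "D \<in> MDS n"
    and row: "\<exists>j<n. j \<noteq> l \<and> D $$ (k, j) = 1"
    and col: "\<exists>i<n. i \<noteq> k \<and> D $$ (i, l) = 1"
  shows "erase_entry k l D \<in> MDS n"
proof -
  have [simp]: "dim_row D = n" "dim_col D = n"
    using D by (auto simp: MDS_iff)
  have idx: "erase_entry k l D $$ (i, j) = (if i = k \<and> j = l then 0 else D $$ (i, j))"
    if "i < n" "j < n" for i j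
    using that by (simp add: erase_entry_def)
  have le: "real_of_rmax (erase_entry k l D $$ (i, j)) \<le> 1" if "i < n" "j < n" for i j
    using D that by (simp add: MDS_iff idx)
  have rows: "\<exists>j<n. erase_entry k l D $$ (i, j) = 1" if i: "i < n" for i
  proof -
    obtain j where "j < n" "i = k \<longrightarrow> j \<noteq> l" "D $$ (i, j) = 1"
      using D i row unfolding MDS_iff by metis
    then show ?thesis using i by (intro exI[of _ j]) (simp add: idx)
  qed
  have cols: "\<exists>i<n. erase_entry k l D $$ (i, j) = 1" if j: "j < n" for j
  proof -
    obtain i where "i < n" "j = l \<longrightarrow> i \<noteq> k" "D $$ (i, j) = 1"
      using D j col unfolding MDS_iff by metis
    then show ?thesis using j by (intro exI[of _ i]) (auto simp: idx)
  qed
  have "erase_entry k l D \<in> carrier_mat n n"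
    by (simp add: erase_entry_def)
  then show ?thesis
    unfolding MDS_iff using le rows cols by blast
qed

section \<open>Necessary conditions for extremality\<close>

text \<open>
  Suppose that the entry is \<open>a\<close> with \<open>0 < a < 1\<close>. It can be erased, since the ones of its row and
  column lie elsewhere. The second matrix is \<open>B = min 1 (D / a)\<close>. It keeps the ones of \<open>D\<close>,
  so it is max-doubly stochastic; and \<open>a B = min a D\<close> lies below \<open>D\<close> and restores the erased entry.
\<close>

lemma extreme_zero_one:
  assumes ext: "max_extreme_point (MDS n) D" and "k < n" "l < n"
  shows "D $$ (k, l) = 0 \<or> D $$ (k, l) = 1"
proof (rule ccontr)
  assume no: "\<not> ?thesis"
  define a where "a = real_of_rmax (D $$ (k, l))"
  have D: "D \<in> MDS n" using ext by (simp add: max_extreme_point_def)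
  have dim [simp]: "dim_row D = n" "dim_col D = n"
    using D by (auto simp: MDS_iff)
  have nonneg: "0 \<le> real_of_rmax x" for x
    using real_of_rmax by simp
  have a_le: "a \<le> 1" using D assms by (auto simp: MDS_iff a_def)
  have a0: "0 < a"
    using no nonneg[of "D $$ (k, l)"] unfolding a_def
    by (metis real_of_rmax_0 real_of_rmax_inject order_le_less)
  have a1: "a < 1"
    using no a_le unfolding a_def by (metis real_of_rmax_1 real_of_rmax_inject order_le_less)
  have rep: "real_of_rmax (Abs_rmax x) = x" if "0 \<le> x" for x
    using that by (simp add: Abs_rmax_inverse)
  define B where "B = mat n n (\<lambda>(i, j). Abs_rmax (min 1 (real_of_rmax (D $$ (i, j)) / a)))"
  have B_idx: "real_of_rmax (B $$ (i, j)) = min 1 (real_of_rmax (D $$ (i, j)) / a)"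
    if "i < n" "j < n" for i j
    using that a0 nonneg by (simp add: B_def rep)
  have B_one: "B $$ (i, j) = 1" if "i < n" "j < n" "D $$ (i, j) = 1" for i j
  proof -
    have "real_of_rmax (B $$ (i, j)) = real_of_rmax 1"
      using that a0 a1 by (simp add: B_idx)
    then show ?thesis by (simp only: real_of_rmax_inject)
  qed
  have B: "B \<in> MDS n"
    using D unfolding MDS_iff by (metis B_def B_idx B_one mat_carrier min.cobounded1)
  have A: "erase_entry k l D \<in> MDS n"
  proof (rule erase_entry_MDS[OF D])
    show "\<exists>j<n. j \<noteq> l \<and> D $$ (k, j) = 1"
      using D no assms unfolding MDS_iff by metis
    show "\<exists>i<n. i \<noteq> k \<and> D $$ (i, l) = 1"
      using D no assms unfolding MDS_iff by metis
  qed
  have "D = 1 \<cdot>\<^sub>m erase_entry k l D + Abs_rmax a \<cdot>\<^sub>m B"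
  proof (rule eq_matI)
    fix i j assume "i < dim_row (1 \<cdot>\<^sub>m erase_entry k l D + Abs_rmax a \<cdot>\<^sub>m B)"
      and "j < dim_col (1 \<cdot>\<^sub>m erase_entry k l D + Abs_rmax a \<cdot>\<^sub>m B)"
    then have ij: "i < n" "j < n" by (auto simp: B_def)
    have "a * min 1 (real_of_rmax (D $$ (i, j)) / a) = min a (real_of_rmax (D $$ (i, j)))"
      using a0 by (auto simp: min_def field_simps)
    moreover have "(1 \<cdot>\<^sub>m erase_entry k l D + Abs_rmax a \<cdot>\<^sub>m B) $$ (i, j) =
        erase_entry k l D $$ (i, j) + Abs_rmax a * B $$ (i, j)"
      using ij by (simp add: B_def erase_entry_def)
    ultimately have "real_of_rmax ((1 \<cdot>\<^sub>m erase_entry k l D + Abs_rmax a \<cdot>\<^sub>m B) $$ (i, j)) =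
        max (real_of_rmax (erase_entry k l D $$ (i, j))) (min a (real_of_rmax (D $$ (i, j))))"
      using a0 B_idx[OF ij] by (simp add: plus_rmax.rep_eq times_rmax.rep_eq rep)
    also have "\<dots> = real_of_rmax (D $$ (i, j))"
      using ij a0 by (auto simp: erase_entry_def a_def)
    finally show "D $$ (i, j) = (1 \<cdot>\<^sub>m erase_entry k l D + Abs_rmax a \<cdot>\<^sub>m B) $$ (i, j)"
      by (simp add: real_of_rmax_inject)
  qed (simp_all add: B_def)
  moreover have "1 + Abs_rmax a = 1"
    using a0 a1 by (simp add: rmax_add_eq_1_iff rep)
  ultimately have "D = erase_entry k l D \<or> D = B"
    by (intro max_extreme_pointD[OF ext A B])
  then show False
  proof
    assume eq: "D = erase_entry k l D"
    have "erase_entry k l D $$ (k, l) = 0"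
      using assms by (simp add: erase_entry_def)
    then show False using eq no by simp
  next
    assume "D = B"
    then have "a = 1"
      using B_idx[OF assms(2,3)] a0 by (simp add: a_def)
    then show False using a1 by simp
  qed
qed

definition erasable :: "'a set \<Rightarrow> 'b set \<Rightarrow> ('a \<Rightarrow> 'b \<Rightarrow> bool) \<Rightarrow> 'a \<Rightarrow> 'b \<Rightarrow> bool" where
  "erasable I J R i j \<longleftrightarrow> i \<in> I \<and> j \<in> J \<and> R i j \<and>
     (\<exists>j'\<in>J. j' \<noteq> j \<and> R i j') \<and> (\<exists>i'\<in>I. i' \<noteq> i \<and> R i' j)"

lemma extreme_erasable_unique:
  assumes ext: "max_extreme_point (MDS n) D"
    and 1: "erasable {..<n} {..<n} (\<lambda>i j. D $$ (i, j) = 1) i j"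
    and 2: "erasable {..<n} {..<n} (\<lambda>i j. D $$ (i, j) = 1) i' j'"
  shows "i = i' \<and> j = j'"
proof (rule ccontr)
  assume ne: "\<not> ?thesis"
  have D: "D \<in> MDS n" using ext by (simp add: max_extreme_point_def)
  have dim [simp]: "dim_row D = n" "dim_col D = n"
    using D by (auto simp: MDS_iff)
  have A: "erase_entry i j D \<in> MDS n" and B: "erase_entry i' j' D \<in> MDS n"
    using 1 2 by (auto simp: erasable_def intro!: erase_entry_MDS[OF D])
  have "D = 1 \<cdot>\<^sub>m erase_entry i j D + 1 \<cdot>\<^sub>m erase_entry i' j' D"
    using ne by (intro eq_matI) (auto simp: erase_entry_def)
  then have "D = erase_entry i j D \<or> D = erase_entry i' j' D"
    by (rule max_extreme_pointD[OF ext A B rmax_idem])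
  moreover have "erase_entry i j D $$ (i, j) = 0" "erase_entry i' j' D $$ (i', j') = 0"
    using 1 2 by (auto simp: erasable_def erase_entry_def)
  ultimately show False
    using 1 2 by (auto simp: erasable_def)
qed

section \<open>Block forms of bipartite graphs\<close>

text \<open>
  The enumerations \<open>f\<close> and \<open>g\<close> are existential, so this is the biadjacency matrix up to reordering of
  rows and columns. Relativising to vertex sets lets components be split off one by one.
\<close>

definition biadjacency :: "'a set \<Rightarrow> 'b set \<Rightarrow> ('a \<Rightarrow> 'b \<Rightarrow> bool) \<Rightarrow> 'c :: zero_neq_one mat \<Rightarrow> bool" where
  "biadjacency I J R M \<longleftrightarrow> (\<exists>f g. bij_betw f I {..<dim_row M} \<and> bij_betw g J {..<dim_col M} \<and>
     (\<forall>i\<in>I. \<forall>j\<in>J. M $$ (f i, g j) = of_bool (R i j)))"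

lemma bij_betw_append_interval:
  fixes f g :: "'a \<Rightarrow> nat"
  assumes f: "bij_betw f A {..<a}" and g: "bij_betw g B {..<b}" and "A \<inter> B = {}"
  shows "bij_betw (\<lambda>x. if x \<in> A then f x else a + g x) (A \<union> B) {..<a + b}"
proof -
  have "bij_betw ((+) a \<circ> g) B {a..<a + b}"
    using g by (rule bij_betw_trans) (simp add: bij_betw_def lessThan_atLeast0 add.commute)
  then have "bij_betw (\<lambda>x. if x \<in> A then f x else a + g x) (A \<union> B) ({..<a} \<union> {a..<a + b})"
    using f assms(3) unfolding comp_def by (intro bij_betw_disjoint_Un) auto
  also have "{..<a} \<union> {a..<a + b} = {..<a + b}" by auto
  finally show ?thesis by simp
qed

lemma biadjacency_disjoint_Un:
  assumes M: "biadjacency I J R M" and N: "biadjacency I' J' R N"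
    and disj: "I \<inter> I' = {}" "J \<inter> J' = {}"
    and off: "\<And>i j. i \<in> I \<Longrightarrow> j \<in> J' \<Longrightarrow> \<not> R i j" "\<And>i j. i \<in> I' \<Longrightarrow> j \<in> J \<Longrightarrow> \<not> R i j"
  shows "biadjacency (I \<union> I') (J \<union> J') R
    (four_block_mat M (0\<^sub>m (dim_row M) (dim_col N)) (0\<^sub>m (dim_row N) (dim_col M)) N)"
proof -
  obtain f g where fg: "bij_betw f I {..<dim_row M}" "bij_betw g J {..<dim_col M}"
    "\<forall>i\<in>I. \<forall>j\<in>J. M $$ (f i, g j) = of_bool (R i j)"
    using M by (auto simp: biadjacency_def)
  obtain f' g' where fg': "bij_betw f' I' {..<dim_row N}" "bij_betw g' J' {..<dim_col N}"
    "\<forall>i\<in>I'. \<forall>j\<in>J'. N $$ (f' i, g' j) = of_bool (R i j)"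
    using N by (auto simp: biadjacency_def)
  have bounds: "i \<in> I \<Longrightarrow> f i < dim_row M" "j \<in> J \<Longrightarrow> g j < dim_col M"
    "i' \<in> I' \<Longrightarrow> f' i' < dim_row N" "j' \<in> J' \<Longrightarrow> g' j' < dim_col N" for i j i' j'
    using fg fg' by (auto dest!: bij_betwE)
  show ?thesis
    unfolding biadjacency_def
  proof (intro exI conjI)
    show "bij_betw (\<lambda>i. if i \<in> I then f i else dim_row M + f' i) (I \<union> I')
      {..<dim_row (four_block_mat M (0\<^sub>m (dim_row M) (dim_col N)) (0\<^sub>m (dim_row N) (dim_col M)) N)}"
      using bij_betw_append_interval[OF fg(1) fg'(1) disj(1)] by simp
    show "bij_betw (\<lambda>j. if j \<in> J then g j else dim_col M + g' j) (J \<union> J')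
      {..<dim_col (four_block_mat M (0\<^sub>m (dim_row M) (dim_col N)) (0\<^sub>m (dim_row N) (dim_col M)) N)}"
      using bij_betw_append_interval[OF fg(2) fg'(2) disj(2)] by simp
  qed (use fg(3) fg'(3) disj off bounds in \<open>auto simp: trans_less_add1\<close>)
qed

lemma bij_betw_lessThan_card:
  assumes "finite A"
  obtains f where "bij_betw f A {..<card A}"
  using ex_bij_betw_finite_nat[OF assms] by (auto simp: atLeast0LessThan)

lemma biadjacency_ones_col:
  assumes "finite I" "\<And>i. i \<in> I \<Longrightarrow> R i j"
  shows "biadjacency I {j} R (ones_col (card I))"
proof -
  obtain f where f: "bij_betw f I {..<card I}"
    using bij_betw_lessThan_card assms(1) by blast
  have "bij_betw (\<lambda>_. 0) {j} {..<Suc 0}"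
    by (auto simp: bij_betw_def)
  then show ?thesis
    using f assms bij_betwE[OF f] unfolding biadjacency_def ones_col_def by force
qed

lemma biadjacency_transpose:
  assumes "biadjacency J I (\<lambda>j i. R i j) M"
  shows "biadjacency I J R (transpose_mat M)"
proof -
  obtain f g where "bij_betw f J {..<dim_row M}" "bij_betw g I {..<dim_col M}"
    "\<forall>j\<in>J. \<forall>i\<in>I. M $$ (f j, g i) = of_bool (R i j)"
    using assms by (auto simp: biadjacency_def)
  then show ?thesis
    unfolding biadjacency_def
    by (intro exI[of _ g] exI[of _ f]) (auto dest!: bij_betwE)
qed

text \<open>The hook block has its two centres in position \<open>0\<close>, so an enumeration must start at a given vertex.\<close>

lemma bij_betw_lessThan_card_at_0:
  assumes A: "finite A" "a \<in> A"
  shows "\<exists>f. bij_betw f A {..<card A} \<and> f a = (0 :: nat)"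
proof -
  obtain h where h: "bij_betw h A {..<card A}"
    using bij_betw_lessThan_card A(1) by blast
  have "0 < card A" using A by (auto simp: card_gt_0_iff)
  then have "transpose 0 (h a) permutes {..<card A}"
    using bij_betwE[OF h] A(2) by (intro permutes_swap_id) auto
  then have "bij_betw (transpose 0 (h a) \<circ> h) A {..<card A}"
    using h permutes_imp_bij bij_betw_trans by blast
  then show ?thesis by (intro exI[of _ "transpose 0 (h a) \<circ> h"]) simp
qed

lemma biadjacency_hook:
  assumes fin: "finite I" "finite J" and i0: "i0 \<in> I" and j0: "j0 \<in> J"
    and R: "\<And>i j. i \<in> I \<Longrightarrow> j \<in> J \<Longrightarrow> R i j \<longleftrightarrow> i = i0 \<or> j = j0"
  shows "biadjacency I J R (hook_mat (card I) (card J))"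
proof -
  obtain f where f: "bij_betw f I {..<card I}" "f i0 = 0"
    using bij_betw_lessThan_card_at_0[OF fin(1) i0] by blast
  obtain g where g: "bij_betw g J {..<card J}" "g j0 = 0"
    using bij_betw_lessThan_card_at_0[OF fin(2) j0] by blast
  have zero: "f i = 0 \<longleftrightarrow> i = i0" "g j = 0 \<longleftrightarrow> j = j0" if "i \<in> I" "j \<in> J" for i j
    using f g that i0 j0 by (metis bij_betw_def inj_on_def)+
  show ?thesis
    unfolding biadjacency_def
    by (rule exI[of _ f], rule exI[of _ g])
      (use f g R zero bij_betwE[OF f(1)] bij_betwE[OF g(1)] in \<open>auto simp: hook_mat_def\<close>)
qed

section \<open>Star forests and double stars\<close>

lemma row_stars_biadjacency:
  assumes "finite I" "finite J"
    and "\<And>i. i \<in> I \<Longrightarrow> \<exists>j\<in>J. R i j"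
    and "\<And>j. j \<in> J \<Longrightarrow> \<exists>!i. i \<in> I \<and> R i j"
  shows "\<exists>ns. (\<forall>m\<in>set ns. 0 < m) \<and> biadjacency I J R (ones_sum [] ns)"
  using assms
proof (induction I arbitrary: J rule: finite_induct)
  case empty
  then have "J = {}" by auto
  then have "biadjacency {} J R (ones_sum [] [])"
    by (auto simp: biadjacency_def ones_sum_def bij_betw_def)
  then show ?case by (intro exI[of _ "[]"]) simp
next
  case (insert i I)
  define K where "K = {j \<in> J. R i j}"
  have K: "finite K" "K \<noteq> {}" "K \<subseteq> J"
    using insert.prems(1) insert.prems(2)[of i] by (auto simp: K_def)
  have only: "\<not> R i' j" if "i' \<in> I" "j \<in> K" for i' j
    using insert.prems(3)[of j] that insert.hyps by (auto simp: K_def)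
  have "\<exists>ns. (\<forall>m\<in>set ns. 0 < m) \<and> biadjacency I (J - K) R (ones_sum [] ns)"
  proof (rule insert.IH)
    show "\<exists>j\<in>J - K. R i' j" if "i' \<in> I" for i'
      using insert.prems(2)[of i'] only that by auto
    show "\<exists>!i'. i' \<in> I \<and> R i' j" if "j \<in> J - K" for j
      using insert.prems(3)[of j] that by (auto simp: K_def)
  qed (use insert.prems in auto)
  then obtain ns where ns: "\<forall>m\<in>set ns. 0 < m" "biadjacency I (J - K) R (ones_sum [] ns)"
    by blast
  have "biadjacency {i} K R (transpose_mat (ones_col (card K)))"
    by (intro biadjacency_transpose biadjacency_ones_col) (use K in \<open>auto simp: K_def\<close>)
  then have "biadjacency ({i} \<union> I) (K \<union> (J - K)) R
      (four_block_mat (transpose_mat (ones_col (card K)))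
        (0\<^sub>m (dim_row (transpose_mat (ones_col (card K)))) (dim_col (ones_sum [] ns)))
        (0\<^sub>m (dim_row (ones_sum [] ns)) (dim_col (transpose_mat (ones_col (card K)))))
        (ones_sum [] ns))"
    by (rule biadjacency_disjoint_Un[OF _ ns(2)])
      (use insert.hyps only in \<open>auto simp: K_def\<close>)
  then have "biadjacency (insert i I) (K \<union> (J - K)) R (ones_sum [] (card K # ns))"
    by (simp add: ones_sum_def Let_def)
  moreover have "K \<union> (J - K) = J" using K by auto
  ultimately show ?case
    using ns K by (intro exI[of _ "card K # ns"]) (auto simp: card_gt_0_iff)
qed

text \<open>
  The column centres of degree at least two are peeled off first; what remains then consists of
  stars centred at rows, single edges included.
\<close>

lemma star_forest_biadjacency:
  assumes "finite I" "finite J"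
    and "\<And>i. i \<in> I \<Longrightarrow> \<exists>j\<in>J. R i j"
    and "\<And>j. j \<in> J \<Longrightarrow> \<exists>i\<in>I. R i j"
    and "\<And>i j. \<not> erasable I J R i j"
  shows "\<exists>ms ns. (\<forall>m\<in>set ms. 0 < m) \<and> (\<forall>m\<in>set ns. 0 < m) \<and> biadjacency I J R (ones_sum ms ns)"
  using assms
proof (induction "card J" arbitrary: I J rule: less_induct)
  case less
  show ?case
  proof (cases "\<forall>j\<in>J. \<exists>!i. i \<in> I \<and> R i j")
    case True
    then obtain ns where "\<forall>m\<in>set ns. 0 < m" "biadjacency I J R (ones_sum [] ns)"
      using row_stars_biadjacency[of I J R] less.prems by blast
    then show ?thesis by (intro exI[of _ "[]"] exI[of _ ns]) simp
  next
    case False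
    then obtain j i1 i2 where j: "j \<in> J" "i1 \<in> I" "i2 \<in> I" "i1 \<noteq> i2" "R i1 j" "R i2 j"
      using less.prems(4) by (metis (full_types))
    define K where "K = {i \<in> I. R i j}"
    have K: "finite K" "K \<noteq> {}" "K \<subseteq> I"
      using less.prems j by (auto simp: K_def)
    have only: "j' = j" if "i \<in> K" "j' \<in> J" "R i j'" for i j'
    proof (rule ccontr)
      assume "j' \<noteq> j"
      moreover have "\<exists>i'\<in>I. i' \<noteq> i \<and> R i' j"
        using j by (cases "i1 = i") auto
      ultimately have "erasable I J R i j"
        using that j by (auto simp: erasable_def K_def)
      then show False using less.prems(5) by blast
    qed
    have "\<exists>ms ns. (\<forall>m\<in>set ms. 0 < m) \<and> (\<forall>m\<in>set ns. 0 < m) \<and>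
        biadjacency (I - K) (J - {j}) R (ones_sum ms ns)"
    proof (rule less.hyps)
      show "card (J - {j}) < card J"
        using j less.prems by (intro card_Diff1_less) auto
      show "\<exists>j'\<in>J - {j}. R i j'" if "i \<in> I - K" for i
        using less.prems(3)[of i] that by (auto simp: K_def)
      show "\<exists>i\<in>I - K. R i j'" if "j' \<in> J - {j}" for j'
        using less.prems(4)[of j'] only that by blast
      show "\<not> erasable (I - K) (J - {j}) R i j'" for i j'
        using less.prems(5)[of i j'] by (auto simp: erasable_def)
    qed (use less.prems in auto)
    then obtain ms ns where mn: "\<forall>m\<in>set ms. 0 < m" "\<forall>m\<in>set ns. 0 < m"
      "biadjacency (I - K) (J - {j}) R (ones_sum ms ns)"
      by blast
    have "biadjacency K {j} R (ones_col (card K))"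
      by (intro biadjacency_ones_col) (use K in \<open>auto simp: K_def\<close>)
    then have "biadjacency (K \<union> (I - K)) ({j} \<union> (J - {j})) R
        (four_block_mat (ones_col (card K))
          (0\<^sub>m (dim_row (ones_col (card K))) (dim_col (ones_sum ms ns)))
          (0\<^sub>m (dim_row (ones_sum ms ns)) (dim_col (ones_col (card K)))) (ones_sum ms ns))"
    proof (rule biadjacency_disjoint_Un[OF _ mn(3)])
      show "\<not> R i j'" if "i \<in> K" "j' \<in> J - {j}" for i j'
        using only that by blast
      show "\<not> R i j'" if "i \<in> I - K" "j' \<in> {j}" for i j'
        using that by (simp add: K_def)
    qed auto
    then have "biadjacency (K \<union> (I - K)) ({j} \<union> (J - {j})) R (ones_sum (card K # ms) ns)"
      by (simp add: ones_sum_def Let_def)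
    moreover have "K \<union> (I - K) = I" "{j} \<union> (J - {j}) = J" using K j by auto
    ultimately show ?thesis
      using mn K by (intro exI[of _ "card K # ms"] exI[of _ ns]) (auto simp: card_gt_0_iff)
  qed
qed

text \<open>
  The component of the erasable edge \<open>(i0, j0)\<close> has as vertices exactly the neighbours of its two
  ends. A neighbour \<open>i \<noteq> i0\<close> of \<open>j0\<close> with a second neighbour would make \<open>(i, j0)\<close> another erasable
  edge, and the same holds for neighbours of \<open>i0\<close>.
\<close>

lemma double_star_biadjacency:
  assumes fin: "finite I" "finite J"
    and rows: "\<And>i. i \<in> I \<Longrightarrow> \<exists>j\<in>J. R i j"
    and cols: "\<And>j. j \<in> J \<Longrightarrow> \<exists>i\<in>I. R i j"
    and e: "erasable I J R i0 j0"
    and unique: "\<And>i j. erasable I J R i j \<Longrightarrow> i = i0 \<and> j = j0"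
  shows "\<exists>q r ms ns. 1 < q \<and> 1 < r \<and> (\<forall>m\<in>set ms. 0 < m) \<and> (\<forall>m\<in>set ns. 0 < m) \<and>
    biadjacency I J R (diag_block_mat [hook_mat q r, ones_sum ms ns])"
proof -
  define I1 where "I1 = {i \<in> I. R i j0}"
  define J1 where "J1 = {j \<in> J. R i0 j}"
  obtain i1 j1 where e': "i0 \<in> I" "j0 \<in> J" "R i0 j0" "i1 \<in> I" "i1 \<noteq> i0" "R i1 j0"
    "j1 \<in> J" "j1 \<noteq> j0" "R i0 j1"
    using e by (auto simp: erasable_def)
  have fin1: "finite I1" "finite J1" using fin by (auto simp: I1_def J1_def)
  have leaf_row: "j = j0" if "i \<in> I1" "i \<noteq> i0" "j \<in> J" "R i j" for i j
  proof (rule ccontr)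
    assume "j \<noteq> j0"
    then have "erasable I J R i j0"
      using that e' unfolding erasable_def I1_def by auto
    then show False using unique that(2) by blast
  qed
  have leaf_col: "i = i0" if "j \<in> J1" "j \<noteq> j0" "i \<in> I" "R i j" for i j
  proof (rule ccontr)
    assume "i \<noteq> i0"
    then have "erasable I J R i0 j"
      using that e' unfolding erasable_def J1_def by auto
    then show False using unique that(2) by blast
  qed
  have "\<exists>ms ns. (\<forall>m\<in>set ms. 0 < m) \<and> (\<forall>m\<in>set ns. 0 < m) \<and>
      biadjacency (I - I1) (J - J1) R (ones_sum ms ns)"
  proof (rule star_forest_biadjacency)
    show "\<exists>j\<in>J - J1. R i j" if "i \<in> I - I1" for i
      using rows[of i] leaf_col that e' by (auto simp: I1_def)
    show "\<exists>i\<in>I - I1. R i j" if "j \<in> J - J1" for j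
      using cols[of j] leaf_row that e' by (auto simp: J1_def)
    show "\<not> erasable (I - I1) (J - J1) R i j" for i j
      using unique[of i j] e' by (auto simp: erasable_def I1_def)
  qed (use fin in auto)
  then obtain ms ns where mn: "\<forall>m\<in>set ms. 0 < m" "\<forall>m\<in>set ns. 0 < m"
    "biadjacency (I - I1) (J - J1) R (ones_sum ms ns)"
    by blast
  have "biadjacency I1 J1 R (hook_mat (card I1) (card J1))"
  proof (rule biadjacency_hook[OF fin1])
    show "R i j \<longleftrightarrow> i = i0 \<or> j = j0" if "i \<in> I1" "j \<in> J1" for i j
    proof
      show "i = i0 \<or> j = j0" if "R i j"
        using leaf_row[of i j] that \<open>i \<in> I1\<close> \<open>j \<in> J1\<close> by (auto simp: J1_def)
      show "R i j" if "i = i0 \<or> j = j0"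
        using that \<open>i \<in> I1\<close> \<open>j \<in> J1\<close> by (auto simp: I1_def J1_def)
    qed
  qed (use e' in \<open>auto simp: I1_def J1_def\<close>)
  then have "biadjacency (I1 \<union> (I - I1)) (J1 \<union> (J - J1)) R
      (four_block_mat (hook_mat (card I1) (card J1))
        (0\<^sub>m (dim_row (hook_mat (card I1) (card J1))) (dim_col (ones_sum ms ns)))
        (0\<^sub>m (dim_row (ones_sum ms ns)) (dim_col (hook_mat (card I1) (card J1)))) (ones_sum ms ns))"
  proof (rule biadjacency_disjoint_Un[OF _ mn(3)])
    show "\<not> R i j" if "i \<in> I1" "j \<in> J - J1" for i j
      using leaf_row[of i j] that e' by (auto simp: J1_def)
    show "\<not> R i j" if "i \<in> I - I1" "j \<in> J1" for i j
      using leaf_col[of j i] that e' by (auto simp: I1_def)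
  qed auto
  moreover have "I1 \<union> (I - I1) = I" "J1 \<union> (J - J1) = J" by (auto simp: I1_def J1_def)
  moreover have "diag_block_mat [A, B] = four_block_mat A (0\<^sub>m (dim_row A) (dim_col B))
      (0\<^sub>m (dim_row B) (dim_col A)) B" for A B :: "rmax mat"
    by (simp add: Let_def) (intro eq_matI; auto)
  ultimately have "biadjacency I J R (diag_block_mat [hook_mat (card I1) (card J1), ones_sum ms ns])"
    by simp
  moreover have "1 < card I1" "1 < card J1"
  proof -
    have "card {i0, i1} \<le> card I1" "card {j0, j1} \<le> card J1"
      using e' fin1 by (intro card_mono; auto simp: I1_def J1_def)+
    then show "1 < card I1" "1 < card J1" using e' by auto
  qed
  ultimately show ?thesis using mn by blast
qed

section \<open>Permutation equivalence\<close>

lemma mult_mat_index_sum: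
  assumes "A \<in> carrier_mat n m" "B \<in> carrier_mat m l" "i < n" "j < l"
  shows "(A * B) $$ (i, j) = (\<Sum>k\<in>{0..<m}. A $$ (i, k) * B $$ (k, j))"
  using assms by (simp add: scalar_prod_def)

lemma biadjacency_imp_permutation_equivalent:
  fixes D E :: "rmax mat"
  assumes D: "D \<in> carrier_mat n n"
    and zero_one: "\<And>i j. i < n \<Longrightarrow> j < n \<Longrightarrow> D $$ (i, j) = 0 \<or> D $$ (i, j) = 1"
    and E: "biadjacency {..<n} {..<n} (\<lambda>i j. D $$ (i, j) = 1) E"
  shows "E \<in> carrier_mat n n"
    and "\<exists>P1\<in>permutation_matrices n. \<exists>P2\<in>permutation_matrices n. D = P1 * E * P2"
proof -
  obtain f g where fg: "bij_betw f {..<n} {..<dim_row E}" "bij_betw g {..<n} {..<dim_col E}"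
    and DE: "\<And>i j. i < n \<Longrightarrow> j < n \<Longrightarrow> E $$ (f i, g j) = of_bool (D $$ (i, j) = 1)"
    using E by (auto simp: biadjacency_def)
  have [simp]: "dim_row E = n" "dim_col E = n"
    using fg[THEN bij_betw_same_card] by auto
  show E: "E \<in> carrier_mat n n" by auto
  \<comment> \<open>Since \<^const>\<open>permutes\<close> speaks of all naturals, the enumerations are continued by the identity.\<close>
  define p where "p i = (if i < n then f i else i)" for i
  define q where "q i = (if i < n then g i else i)" for i
  have "bij_betw p {..<n} {..<n}" "bij_betw q {..<n} {..<n}"
    using fg bij_betw_cong[of "{..<n}" f p "{..<n}"] bij_betw_cong[of "{..<n}" g q "{..<n}"]
    by (simp_all add: p_def q_def)
  then have perm: "p permutes {..<n}" "q permutes {..<n}"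
    by (intro bij_imp_permutes; simp add: p_def q_def)+
  have lt: "i < n \<Longrightarrow> p i < n" "i < n \<Longrightarrow> q i < n" for i
    using perm permutes_in_image by (metis lessThan_iff)+
  \<comment> \<open>\<open>P1\<close> moves row \<open>p i\<close> to \<open>i\<close> and \<open>P2\<close> moves column \<open>q j\<close> to \<open>j\<close>, so one trivial permutation each suffices.\<close>
  define P1 :: "rmax mat" where "P1 = mat n n (\<lambda>(i, j). 1\<^sub>m n $$ (p i, id j))"
  define P2 :: "rmax mat" where "P2 = mat n n (\<lambda>(i, j). 1\<^sub>m n $$ (id i, q j))"
  have carr: "P1 \<in> carrier_mat n n" "P2 \<in> carrier_mat n n"
    by (auto simp: P1_def P2_def)
  have P: "P1 \<in> permutation_matrices n" "P2 \<in> permutation_matrices n"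
    unfolding P1_def P2_def permutation_matrices_def using perm permutes_id by blast+
  have 1: "(P1 * E) $$ (i, k) = E $$ (p i, k)" if "i < n" "k < n" for i k
  proof -
    have "(P1 * E) $$ (i, k) = (\<Sum>l\<in>{0..<n}. P1 $$ (i, l) * E $$ (l, k))"
      by (rule mult_mat_index_sum) (use that carr E in auto)
    also have "\<dots> = (\<Sum>l\<in>{0..<n}. if p i = l then E $$ (l, k) else 0)"
      using that lt by (intro sum.cong) (auto simp: P1_def)
    finally show ?thesis using lt that by simp
  qed
  have "D = P1 * E * P2"
  proof (rule eq_matI)
    fix i j assume "i < dim_row (P1 * E * P2)" "j < dim_col (P1 * E * P2)"
    then have ij: "i < n" "j < n" using carr by auto
    have "(P1 * E * P2) $$ (i, j) = (\<Sum>k\<in>{0..<n}. (P1 * E) $$ (i, k) * P2 $$ (k, j))"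
      by (rule mult_mat_index_sum) (use ij carr E in auto)
    also have "\<dots> = (\<Sum>k\<in>{0..<n}. if k = q j then E $$ (p i, k) else 0)"
      using ij lt by (intro sum.cong) (auto simp: 1 P2_def simp del: index_mult_mat(1))
    also have "\<dots> = E $$ (p i, q j)" using lt ij by simp
    also have "\<dots> = D $$ (i, j)" using DE zero_one ij by (force simp: p_def q_def)
    finally show "D $$ (i, j) = (P1 * E * P2) $$ (i, j)" by simp
  qed (use D carr in auto)
  then show "\<exists>P1\<in>permutation_matrices n. \<exists>P2\<in>permutation_matrices n. D = P1 * E * P2"
    using P by blast
qed

theorem theorem2p20:
  fixes n :: nat and D :: "rmax mat"
  assumes "max_extreme_point (MDS n) D"
  shows "\<exists>P1\<in>permutation_matrices n. \<exists>P2\<in>permutation_matrices n. \<exists>E.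
           (E1_form n E \<or> E2_form n E) \<and> D = P1 * E * P2"
proof -
  let ?R = "\<lambda>i j. D $$ (i, j) = 1"
  have D: "D \<in> MDS n" using assms by (simp add: max_extreme_point_def)
  then have carr: "D \<in> carrier_mat n n"
    and rows: "\<And>i. i \<in> {..<n} \<Longrightarrow> \<exists>j\<in>{..<n}. ?R i j"
    and cols: "\<And>j. j \<in> {..<n} \<Longrightarrow> \<exists>i\<in>{..<n}. ?R i j"
    by (auto simp: MDS_iff)
  note zero_one = extreme_zero_one[OF assms]
  note equivalent = biadjacency_imp_permutation_equivalent[OF carr zero_one]
  have "\<exists>E. (E1_form n E \<or> E2_form n E) \<and> biadjacency {..<n} {..<n} ?R E"
  proof (cases "\<exists>i j. erasable {..<n} {..<n} ?R i j")
    case False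
    then obtain ms ns where mn: "\<forall>m\<in>set ms. 0 < m" "\<forall>m\<in>set ns. 0 < m"
      "biadjacency {..<n} {..<n} ?R (ones_sum ms ns)"
      using star_forest_biadjacency[of "{..<n}" "{..<n}" ?R] rows cols by blast
    moreover have "ones_sum ms ns \<in> carrier_mat n n"
      using equivalent(1) mn(3) by blast
    ultimately show ?thesis unfolding E1_form_def by blast
  next
    case True
    then obtain i0 j0 where e: "erasable {..<n} {..<n} ?R i0 j0" by blast
    obtain q r ms ns where mn: "1 < q" "1 < r" "\<forall>m\<in>set ms. 0 < m" "\<forall>m\<in>set ns. 0 < m"
      "biadjacency {..<n} {..<n} ?R (diag_block_mat [hook_mat q r, ones_sum ms ns])"
      using double_star_biadjacency[of "{..<n}" "{..<n}" ?R i0 j0] rows cols e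
        extreme_erasable_unique[OF assms _ e] by blast
    moreover have "diag_block_mat [hook_mat q r, ones_sum ms ns] \<in> carrier_mat n n"
      using equivalent(1) mn(5) by blast
    ultimately show ?thesis unfolding E2_form_def by blast
  qed
  then show ?thesis using equivalent(2) by blast
qed

end
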